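(* Let $n>1$ be an integer and let $G$ be a finite group having subgroups $A$, $B$ and $M$ such that (1) $|A|=|B|=|M|=nk$ and $|G|=n^3k$, where $k=|A\cap B|$; (2) $AM=\{am\mid a\in A,\ m\in M\}$ and $BM=\{bm\mid b\in B,\ m\in M\}$ are subgroups of $G$ of order $n^2k$; (3) $G=AMB$; (4) $AB\cap BA=A\cup B$. Then there is a projective plane $\pi$ of order $n$ on which $G$ acts by collineations such that the group of collineations induced by $G$ is a soft group of $\pi$; in particular $\pi$ is a soft plane.
   Context: A flag of a projective plane is an incident point–line pair. A collineation group $H$ of a finite projective plane is a soft group if $H$ fixes some flag $(\infty,L_\infty)$ and is transitive on the set of flags $(w,W)$ with $w$ not on $L_\infty$ and $\infty$ not on $W$. A projective plane is a soft plane if it admits a soft group. The action of $G$ need not be faithful. *)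

theory Defs
  imports "HOL-Algebra.Algebra"
begin

text \<open>A projective plane is given by its set \<open>P\<close> of points and its set \<open>L\<close> of lines, each line being
  identified with the set of points incident with it.\<close>

locale projective_plane =
  fixes P :: "'p set" and L :: "'p set set"
  assumes lines_subset: "l \<in> L \<Longrightarrow> l \<subseteq> P"
    and joining_line: "\<lbrakk>p \<in> P; q \<in> P; p \<noteq> q\<rbrakk> \<Longrightarrow> \<exists>!l. l \<in> L \<and> p \<in> l \<and> q \<in> l"
    and meeting_point: "\<lbrakk>l \<in> L; m \<in> L; l \<noteq> m\<rbrakk> \<Longrightarrow> \<exists>!p. p \<in> l \<and> p \<in> m"
    and quadrangle: "\<exists>Q. Q \<subseteq> P \<and> card Q = 4 \<and> (\<forall>l\<in>L. card (Q \<inter> l) \<le> 2)"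

definition projective_plane_of_order :: "nat \<Rightarrow> 'p set \<Rightarrow> 'p set set \<Rightarrow> bool" where
  "projective_plane_of_order n P L \<longleftrightarrow> projective_plane P L \<and> (\<forall>l\<in>L. card l = n + 1)"

definition flags :: "'p set \<Rightarrow> 'p set set \<Rightarrow> ('p \<times> 'p set) set" where
  "flags P L = {(p, l). p \<in> P \<and> l \<in> L \<and> p \<in> l}"

text \<open>As in \<^const>\<open>auto\<close>, permutations of \<open>P\<close> are made extensional, so that distinct
  functions are distinct permutations of the points.\<close>

definition collineations :: "'p set \<Rightarrow> 'p set set \<Rightarrow> ('p \<Rightarrow> 'p) set" where
  "collineations P L = {\<alpha> \<in> Bij P. (\<lambda>l. \<alpha> ` l) ` L = L}"

definition CollineationGroup :: "'p set \<Rightarrow> 'p set set \<Rightarrow> ('p \<Rightarrow> 'p) monoid" where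
  "CollineationGroup P L = BijGroup P \<lparr>carrier := collineations P L\<rparr>"

lemma (in projective_plane) subgroup_collineations:
  "subgroup (collineations P L) (BijGroup P)"
proof (rule group.subgroupI[OF group_BijGroup])
  show "collineations P L \<subseteq> carrier (BijGroup P)"
    by (auto simp: collineations_def BijGroup_def)
  have "(\<lambda>x\<in>P. x) ` l = l" if "l \<in> L" for l
    using lines_subset[OF that] by force
  then have "(\<lambda>l. (\<lambda>x\<in>P. x) ` l) ` L = L"
    by simp
  then show "collineations P L \<noteq> {}"
    unfolding collineations_def using id_Bij[of P] by blast
next
  fix \<alpha> assume "\<alpha> \<in> collineations P L"
  then have \<alpha>: "\<alpha> \<in> Bij P" "(\<lambda>l. \<alpha> ` l) ` L = L"
    by (auto simp: collineations_def)
  let ?\<beta> = "\<lambda>x\<in>P. inv_into P \<alpha> x"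
  have inv: "?\<beta> ` (\<alpha> ` l) = l" if "l \<in> L" for l
  proof -
    have "l \<subseteq> P" by (rule lines_subset[OF that])
    have "inj_on \<alpha> P" "\<alpha> ` P = P"
      using \<alpha>(1) by (auto simp: Bij_def bij_betw_def)
    then have "?\<beta> (\<alpha> x) = x" if "x \<in> l" for x
      using that \<open>l \<subseteq> P\<close> by (auto simp: inv_into_f_f)
    then have "(\<lambda>x. ?\<beta> (\<alpha> x)) ` l = (\<lambda>x. x) ` l"
      by (rule image_cong[OF refl])
    then show ?thesis
      unfolding image_image by simp
  qed
  have "(\<lambda>l. ?\<beta> ` l) ` ((\<lambda>l. \<alpha> ` l) ` L) = L"
    using inv by (simp add: image_comp comp_def)
  then have "(\<lambda>l. ?\<beta> ` l) ` L = L"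
    unfolding \<alpha>(2) .
  then show "inv\<^bsub>BijGroup P\<^esub> \<alpha> \<in> collineations P L"
    using \<alpha>(1) by (simp add: inv_BijGroup restrict_inv_into_Bij collineations_def)
next
  fix \<alpha> \<beta> assume "\<alpha> \<in> collineations P L" "\<beta> \<in> collineations P L"
  then have \<alpha>: "\<alpha> \<in> Bij P" "(\<lambda>l. \<alpha> ` l) ` L = L" and \<beta>: "\<beta> \<in> Bij P" "(\<lambda>l. \<beta> ` l) ` L = L"
    by (auto simp: collineations_def)
  have "compose P \<alpha> \<beta> ` l = \<alpha> ` (\<beta> ` l)" if "l \<in> L" for l
    using lines_subset[OF that] by (force simp: compose_def)
  then have "(\<lambda>l. compose P \<alpha> \<beta> ` l) ` L = (\<lambda>l. \<alpha> ` l) ` ((\<lambda>l. \<beta> ` l) ` L)"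
    by (simp add: image_comp comp_def)
  then show "\<alpha> \<otimes>\<^bsub>BijGroup P\<^esub> \<beta> \<in> collineations P L"
    using \<alpha> \<beta> by (simp add: collineations_def BijGroup_def compose_Bij)
qed

lemma (in projective_plane) group_CollineationGroup: "group (CollineationGroup P L)"
  unfolding CollineationGroup_def
  by (rule group.subgroup_imp_group[OF group_BijGroup subgroup_collineations])

definition soft_group :: "'p set \<Rightarrow> 'p set set \<Rightarrow> ('p \<Rightarrow> 'p) set \<Rightarrow> bool" where
  "soft_group P L H \<longleftrightarrow>
     projective_plane P L \<and> finite P \<and> subgroup H (CollineationGroup P L) \<and>
     (\<exists>(z, Z) \<in> flags P L.
        (\<forall>\<alpha>\<in>H. \<alpha> z = z \<and> \<alpha> ` Z = Z) \<and>
        (\<forall>(w, W) \<in> flags P L. \<forall>(w', W') \<in> flags P L.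
           w \<notin> Z \<and> z \<notin> W \<and> w' \<notin> Z \<and> z \<notin> W' \<longrightarrow>
           (\<exists>\<alpha>\<in>H. \<alpha> w = w' \<and> \<alpha> ` W = W')))"

definition soft_plane :: "'p set \<Rightarrow> 'p set set \<Rightarrow> bool" where
  "soft_plane P L \<longleftrightarrow> (\<exists>H. soft_group P L H)"

text \<open>An action by collineations need not be faithful; the group it induces is the image
  \<open>\<theta> ` carrier G\<close>.\<close>

definition acts_by_collineations ::
    "('g, 'r) monoid_scheme \<Rightarrow> 'p set \<Rightarrow> 'p set set \<Rightarrow> ('g \<Rightarrow> 'p \<Rightarrow> 'p) \<Rightarrow> bool" where
  "acts_by_collineations G P L \<theta> \<longleftrightarrow> group_hom G (CollineationGroup P L) \<theta>"

end

theory Submission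
  imports Defs
begin

text \<open>The plane is the coset geometry of \<open>G\<close>: affine points \<open>xA\<close>, ideal points \<open>xBM\<close> and one base
  point \<open>G\<close>; lines \<open>hB\<close> (meeting \<open>xA\<close> in the group, together with the ideal point \<open>hBM\<close>), \<open>gAM\<close>
  (with its cosets of \<open>A\<close>, together with the base point), and the line at infinity. The condition
  \<open>AB \<inter> BA = A \<union> B\<close> says that two affine points lie on at most one line \<open>hB\<close>. Hence \<open>(AB - A)A\<close> has
  exactly \<open>n\<^sup>3k - n\<^sup>2k\<close> elements; being disjoint from \<open>AM\<close>, it is the complement of \<open>AM\<close>, so any two
  affine points are joined. All hypotheses are symmetric in \<open>A\<close> and \<open>B\<close>, which gives the dual
  statements. \<open>G\<close> acts by left translation and permutes the affine flags \<open>(xA, xB)\<close> transitively.\<close>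

section \<open>Counting elements of products through cosets\<close>

lemma card_image_eq_of_same_kernel:
  assumes "\<And>x y. x \<in> S \<Longrightarrow> y \<in> S \<Longrightarrow> f x = f y \<longleftrightarrow> g x = g y"
  shows "card (f ` S) = card (g ` S)"
proof -
  have inv: "g (inv_into S f (f x)) = g x" if "x \<in> S" for x
    using assms that by (metis f_inv_into_f imageI inv_into_into)
  have "bij_betw (\<lambda>c. g (inv_into S f c)) (f ` S) (g ` S)"
    unfolding bij_betw_def inj_on_def image_image using inv assms by auto
  then show ?thesis
    by (rule bij_betw_same_card)
qed

context group
begin

lemma mult_inv_cancel:
  assumes "x \<in> carrier G" "y \<in> carrier G"
  shows "x \<otimes> (inv x \<otimes> y) = y"
  using assms by (simp flip: m_assoc)

lemma lcos_eq_iff: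
  assumes "subgroup H G" "x \<in> carrier G" "y \<in> carrier G"
  shows "x <# H = y <# H \<longleftrightarrow> inv x \<otimes> y \<in> H"
proof
  assume "x <# H = y <# H"
  then have "y \<in> x <# H"
    using assms lcos_self by blast
  then show "inv x \<otimes> y \<in> H"
    using subgroup.lcos_module_imp[OF assms(1) is_group assms(2)] by blast
next
  assume "inv x \<otimes> y \<in> H"
  then have "y \<in> x <# H"
    using subgroup.lcos_module_rev[OF assms(1) is_group assms(2,3)] by blast
  then show "x <# H = y <# H"
    using l_repr_independence assms by blast
qed

lemma lcos_subset_carrier:
  assumes "subgroup H G" "x \<in> carrier G"
  shows "x <# H \<subseteq> carrier G"
  using l_coset_subset_G[OF subgroup.subset] assms .

lemma mem_lcos_iff:
  assumes "subgroup H G" "x \<in> carrier G"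
  shows "y \<in> x <# H \<longleftrightarrow> y \<in> carrier G \<and> x <# H = y <# H"
proof
  assume y: "y \<in> x <# H"
  then have "y \<in> carrier G"
    using subgroup.elemlcos_carrier[OF assms(1) is_group assms(2)] by blast
  then show "y \<in> carrier G \<and> x <# H = y <# H"
    using l_repr_independence[OF y assms(2,1)] by blast
next
  assume "y \<in> carrier G \<and> x <# H = y <# H"
  then show "y \<in> x <# H"
    using lcos_self[OF _ assms(1)] by blast
qed

lemma set_multI: "x \<in> H \<Longrightarrow> y \<in> K \<Longrightarrow> x \<otimes> y \<in> H <#> K"
  unfolding set_mult_def by blast

lemma subset_set_mult:
  assumes "S \<subseteq> carrier G" "subgroup H G"
  shows "S \<subseteq> S <#> H"
proof
  fix x assume "x \<in> S"
  moreover have "x = x \<otimes> \<one>"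
    using \<open>x \<in> S\<close> assms(1) by auto
  ultimately show "x \<in> S <#> H"
    using set_multI[OF _ subgroup.one_closed[OF assms(2)]] by metis
qed

lemma card_lcos:
  assumes "H \<subseteq> carrier G" "x \<in> carrier G"
  shows "card (x <# H) = card H"
proof -
  have "x <# H = (\<lambda>y. x \<otimes> y) ` H"
    by (auto simp: l_coset_def)
  then show ?thesis
    using inj_on_g'[OF assms] by (simp add: card_image)
qed

text \<open>The product \<open>S <#> H\<close> is the disjoint union of the cosets
  \<open>x <# H\<close> with \<open>x\<close> in \<open>S\<close>, and each of them has
  \<open>card H\<close> elements.\<close>

lemma card_lcosets_meeting:
  assumes "finite (carrier G)" and H: "subgroup H G" and S: "S \<subseteq> carrier G"
  shows "card ((\<lambda>x. x <# H) ` S) * card H = card (S <#> H)"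
proof -
  have U: "S <#> H = \<Union> ((\<lambda>x. x <# H) ` S)"
    by (auto simp: set_mult_def l_coset_def)
  have fin: "finite S" "finite (S <#> H)"
    using finite_subset[OF S assms(1)]
      finite_subset[OF set_mult_closed[OF S subgroup.subset[OF H]] assms(1)] by auto
  have "card H * card ((\<lambda>x. x <# H) ` S) = card (\<Union> ((\<lambda>x. x <# H) ` S))"
  proof (rule card_partition)
    fix c assume "c \<in> (\<lambda>x. x <# H) ` S"
    then show "card c = card H"
      using card_lcos subgroup.subset[OF H] S by auto
  next
    fix c d assume *: "c \<in> (\<lambda>x. x <# H) ` S" "d \<in> (\<lambda>x. x <# H) ` S" "c \<noteq> d"
    then show "c \<inter> d = {}"
      using lcos_disjoint[OF H] S unfolding LCOSETS_def by blast
  qed (use fin U in auto)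
  then show ?thesis
    using U by (simp add: mult.commute)
qed

text \<open>A product formula for a set \<open>S\<close> that need not be a subgroup. As
  \<open>S\<close> absorbs \<open>D\<close> on the right, it consists of
  \<open>card S / card D\<close> cosets of \<open>D\<close>. The last assumption says that different
  ones lie in different cosets of \<open>H\<close>, so the same number of cosets of \<open>H\<close>
  makes up \<open>S <#> H\<close>.\<close>

lemma card_set_mult_eq:
  assumes fin: "finite (carrier G)" and H: "subgroup H G" and D: "subgroup D G" "D \<subseteq> H"
    and S: "S \<subseteq> carrier G" "S <#> D \<subseteq> S"
    and SH: "\<And>x y. x \<in> S \<Longrightarrow> y \<in> S \<Longrightarrow> inv x \<otimes> y \<in> H \<Longrightarrow> inv x \<otimes> y \<in> D"
  shows "card (S <#> H) * card D = card S * card H"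
proof -
  have "S <#> D = S"
    using S subset_set_mult[OF S(1) D(1)] by blast
  then have "card ((\<lambda>x. x <# D) ` S) * card D = card S"
    using card_lcosets_meeting[OF fin D(1) S(1)] by simp
  moreover have "card ((\<lambda>x. x <# H) ` S) = card ((\<lambda>x. x <# D) ` S)"
  \<comment> \<open>The maps to cosets of \<open>H\<close> and of \<open>D\<close> have the same
    fibres on \<open>S\<close>: one direction is \<open>D \<subseteq> H\<close>, the other is the
    assumption \<open>SH\<close>.\<close>
  proof (rule card_image_eq_of_same_kernel)
    fix x y assume "x \<in> S" "y \<in> S"
    then show "x <# H = y <# H \<longleftrightarrow> x <# D = y <# D"
      using lcos_eq_iff[OF H, of x y] lcos_eq_iff[OF D(1), of x y] D(2) S(1) SH[of x y] by blast
  qed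
  moreover note card_lcosets_meeting[OF fin H S(1)]
  ultimately show ?thesis
    by (metis mult.assoc mult.commute)
qed

lemma card_set_mult_subgroups:
  assumes "finite (carrier G)" "subgroup H G" "subgroup K G"
  shows "card (K <#> H) * card (K \<inter> H) = card K * card H"
proof (rule card_set_mult_eq)
  show "subgroup (K \<inter> H) G"
    using assms subgroups_Inter_pair by blast
  show "K <#> (K \<inter> H) \<subseteq> K"
    using subgroup.m_closed[OF assms(3)] by (auto simp: set_mult_def)
  show "inv x \<otimes> y \<in> K \<inter> H" if "x \<in> K" "y \<in> K" "inv x \<otimes> y \<in> H" for x y
    using that subgroup.m_closed[OF assms(3) subgroup.m_inv_closed[OF assms(3)]] by blast
qed (use assms subgroup.subset in auto)

end

section \<open>Consequences of the hypotheses inside the group, and the duality between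
  \<open>A\<close> and \<open>B\<close>\<close>

locale soft_triple = group G
  for G :: "('a, 'b) monoid_scheme" (structure) +
  fixes A B M :: "'a set" and n k :: nat
  assumes n: "n > 1"
    and fin: "finite (carrier G)"
    and A: "subgroup A G" and B: "subgroup B G" and M: "subgroup M G"
    and k: "k = card (A \<inter> B)"
    and card_A: "card A = n * k" and card_B: "card B = n * k" and card_M: "card M = n * k"
    and card_G: "card (carrier G) = n ^ 3 * k"
    and AM: "subgroup (A <#> M) G" and card_AM: "card (A <#> M) = n\<^sup>2 * k"
    and BM: "subgroup (B <#> M) G" and card_BM: "card (B <#> M) = n\<^sup>2 * k"
    and carrier_eq: "carrier G = (A <#> M) <#> B"
    and AB_BA: "(A <#> B) \<inter> (B <#> A) = A \<union> B"
begin

abbreviation "AM \<equiv> A <#> M"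
abbreviation "BM \<equiv> B <#> M"

text \<open>This is the source of all dual statements. Only the factorization \<open>G = AMB\<close>
  is not visibly symmetric; inverting \<open>a m b\<close> gives an element of \<open>BMA\<close>,
  and every group element is an inverse.\<close>

lemma swap: "soft_triple G B A M n k"
proof (intro soft_triple.intro soft_triple_axioms.intro)
  have "carrier G \<subseteq> (B <#> M) <#> A"
  proof
    fix g assume g: "g \<in> carrier G"
    then obtain a m b where *: "a \<in> A" "m \<in> M" "b \<in> B" "inv g = a \<otimes> m \<otimes> b"
      using carrier_eq inv_closed[OF g] unfolding set_mult_def by blast
    have c: "a \<in> carrier G" "m \<in> carrier G" "b \<in> carrier G"
      using * A B M by (auto dest: subgroup.mem_carrier)
    have "g = inv (a \<otimes> m \<otimes> b)"
      using * g inv_inv[OF g] by simp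
    also have "\<dots> = inv b \<otimes> inv m \<otimes> inv a"
      using c by (simp add: inv_mult_group m_assoc)
    finally show "g \<in> (B <#> M) <#> A"
      using * A B M by (simp add: set_multI subgroup.m_inv_closed)
  qed
  then show "carrier G = (B <#> M) <#> A"
    using set_mult_closed[OF subgroup.subset[OF BM] subgroup.subset[OF A]] by blast
  show "(B <#> A) \<inter> (A <#> B) = B \<union> A"
    using AB_BA by blast
  show "k = card (B \<inter> A)"
    using k by (simp add: Int_commute)
qed (fact is_group n fin A B M card_A card_B card_M card_G AM BM card_AM card_BM)+

lemma k_pos: "k > 0"
  using subgroup.finite_imp_card_positive[OF A fin] card_A by (cases "k = 0") auto

lemma A_subset_AM: "A \<subseteq> AM"
  using subset_set_mult[OF subgroup.subset[OF A] M] .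

lemma subgroup_AB: "subgroup (A \<inter> B) G"
  using A B subgroups_Inter_pair by blast

text \<open>The product formula for \<open>G = (AM)B\<close> leaves exactly \<open>k\<close>
  elements for the intersection \<open>AM \<inter> B\<close>, and the \<open>k\<close> elements of
  \<open>A \<inter> B\<close> are among them.\<close>

lemma AM_Int_B: "AM \<inter> B = A \<inter> B"
proof -
  have "n ^ 3 * k * card (AM \<inter> B) = n\<^sup>2 * k * (n * k)"
    using card_set_mult_subgroups[OF fin B AM] carrier_eq card_G card_AM card_B by simp
  also have "\<dots> = n ^ 3 * k * k"
    by (simp add: power2_eq_square power3_eq_cube)
  finally have "card (AM \<inter> B) = card (A \<inter> B)"
    using n k_pos k by simp
  moreover have "A \<inter> B \<subseteq> AM \<inter> B" "finite (AM \<inter> B)"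
    using A_subset_AM finite_subset[OF subgroup.subset[OF B] fin] by auto
  ultimately show ?thesis
    using card_subset_eq by metis
qed

lemma card_AB: "card (A <#> B) = n\<^sup>2 * k"
proof -
  have "card (A <#> B) * k = n\<^sup>2 * k * k"
    using card_set_mult_subgroups[OF fin B A] card_A card_B unfolding k[symmetric] by (simp add: power2_eq_square ac_simps)
  then show ?thesis
    using k_pos by simp
qed

lemma carrier_cover: "carrier G = (((A <#> B) - A) <#> A) \<union> AM"
proof -
  let ?S = "(A <#> B) - A"
  note sub = A[THEN subgroup.subset] B[THEN subgroup.subset]
  have Ac: "a \<in> carrier G" if "a \<in> A" for a using that sub by blast
  have Bc: "b \<in> carrier G" if "b \<in> B" for b using that sub by blast
  have S: "?S \<subseteq> carrier G"
    using set_mult_closed[OF sub] by blast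
  have A_AB: "A \<subseteq> A <#> B"
    using AB_BA by blast
  \<comment> \<open>The set \<open>AB - A\<close> is a union of cosets of
    \<open>A \<inter> B\<close>. To be shown is that two of its elements in the same coset of
    \<open>A\<close> already lie in the same coset of \<open>A \<inter> B\<close>.\<close>
  have "card (?S <#> A) * card (A \<inter> B) = card ?S * card A"
  proof (rule card_set_mult_eq[OF fin A subgroup_AB _ S])
    show "?S <#> (A \<inter> B) \<subseteq> ?S"
    proof
      fix x assume "x \<in> ?S <#> (A \<inter> B)"
      then obtain a b d where *: "a \<in> A" "b \<in> B" "a \<otimes> b \<notin> A" "d \<in> A" "d \<in> B" "x = a \<otimes> b \<otimes> d"
        unfolding set_mult_def by blast
      then have "x = a \<otimes> (b \<otimes> d)" "b \<otimes> d \<in> B"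
        using Ac Bc B by (auto simp: m_assoc subgroup.m_closed)
      then have "x \<in> A <#> B"
        using * unfolding set_mult_def by blast
      moreover have "a \<otimes> b = x \<otimes> inv d"
        using * Ac Bc by (simp add: m_assoc)
      then have "x \<notin> A"
        using * A subgroup.m_closed subgroup.m_inv_closed by metis
      ultimately show "x \<in> ?S" by blast
    qed
  next
    fix x y assume xy: "x \<in> ?S" "y \<in> ?S" "inv x \<otimes> y \<in> A"
    then obtain a b a' b' where *: "a \<in> A" "b \<in> B" "x = a \<otimes> b" "a' \<in> A" "b' \<in> B" "y = a' \<otimes> b'"
      unfolding set_mult_def by blast
    have c: "a \<in> carrier G" "b \<in> carrier G" "a' \<in> carrier G" "b' \<in> carrier G"
      using * Ac Bc by auto
    \<comment> \<open>With \<open>x = a b\<close> and \<open>y = a' b'\<close>, this element equals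
      \<open>b (inv x y)\<close>, so it lies in \<open>AB\<close> and in \<open>BA\<close>, hence in
      \<open>A \<union> B\<close>. It cannot lie in \<open>A\<close>, since \<open>y = a z\<close>
      is outside \<open>A\<close>. So it lies in \<open>B\<close>, and so does
      \<open>inv x y = inv b z\<close>.\<close>
    define z where "z = inv a \<otimes> a' \<otimes> b'"
    have z1: "z = b \<otimes> (inv x \<otimes> y)"
      using c * by (simp add: z_def inv_mult_group m_assoc[symmetric])
    have aa: "inv a \<otimes> a' \<in> A"
      using * A subgroup.m_closed subgroup.m_inv_closed by metis
    then have "z \<in> A <#> B" "z \<in> B <#> A"
      using * xy set_multI[of "inv a \<otimes> a'" A b' B] set_multI[of b B "inv x \<otimes> y" A] z1 z_def
      by auto
    then have "z \<in> A \<union> B"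
      using AB_BA by blast
    moreover have "y = a \<otimes> z"
      using c * by (simp add: z_def m_assoc[symmetric])
    then have "z \<notin> A"
      using xy * A subgroup.m_closed by (metis DiffD2)
    ultimately have "z \<in> B" by blast
    moreover have "inv x \<otimes> y = inv b \<otimes> z"
      using c * by (simp add: z_def inv_mult_group m_assoc)
    ultimately show "inv x \<otimes> y \<in> A \<inter> B"
      using xy * B subgroup.m_closed subgroup.m_inv_closed by (metis IntI)
  qed auto
  moreover have "card ?S = n\<^sup>2 * k - n * k"
    using card_Diff_subset[OF _ A_AB] card_AB card_A finite_subset[OF sub(1) fin] by simp
  ultimately have "card (?S <#> A) = (n\<^sup>2 * k - n * k) * n"
    using k k_pos card_A by (metis mult.assoc mult_cancel2 neq0_conv)
  also have "\<dots> = n ^ 3 * k - n\<^sup>2 * k"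
    unfolding diff_mult_distrib by (simp add: power2_eq_square power3_eq_cube ac_simps)
  finally have card_SA: "card (?S <#> A) = n ^ 3 * k - n\<^sup>2 * k" .
  have disj: "(?S <#> A) \<inter> AM = {}"
  proof (rule ccontr)
    assume "(?S <#> A) \<inter> AM \<noteq> {}"
    then obtain a b a' where *: "a \<in> A" "b \<in> B" "a \<otimes> b \<notin> A" "a' \<in> A" "a \<otimes> b \<otimes> a' \<in> AM"
      unfolding set_mult_def by blast
    \<comment> \<open>Both outer factors lie in \<open>A\<close>, a subset of the subgroup
      \<open>AM\<close>, so they can be stripped off. The remaining \<open>b\<close> lies in
      \<open>AM \<inter> B = A \<inter> B\<close>, which contradicts \<open>a b\<close> being
      outside \<open>A\<close>.\<close>
    then have "inv a \<otimes> (a \<otimes> b \<otimes> a') \<otimes> inv a' \<in> AM"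
      using A_subset_AM AM A subgroup.m_closed subgroup.m_inv_closed by (metis subsetD)
    then have "b \<in> AM"
      using * Ac Bc by (simp add: m_assoc) (simp add: m_assoc[symmetric])
    then have "b \<in> A"
      using * AM_Int_B by blast
    then show False
      using * A subgroup.m_closed by metis
  qed
  have SA: "(?S <#> A) \<union> AM \<subseteq> carrier G"
    using set_mult_closed[OF S sub(1)] AM subgroup.subset by blast
  then have "card ((?S <#> A) \<union> AM) = (n ^ 3 * k - n\<^sup>2 * k) + n\<^sup>2 * k"
    using card_Un_disjoint[OF _ _ disj] card_SA card_AM fin by (metis finite_Un finite_subset)
  \<comment> \<open>The subtraction is that of the natural numbers; it cancels because
    \<open>n > 1\<close> gives \<open>n\<^sup>2 \<le> n ^ 3\<close>.\<close>
  also have "\<dots> = n ^ 3 * k"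
    using n by (simp add: power_increasing)
  finally show ?thesis
    using card_subset_eq[OF fin SA] card_G by simp
qed

lemma AM_eq_of_A_eq:
  assumes "x \<in> carrier G" "y \<in> carrier G" "x <# A = y <# A"
  shows "x <# AM = y <# AM"
  using assms A_subset_AM by (simp add: lcos_eq_iff A AM) blast

text \<open>Here \<open>inv x \<otimes> y\<close> lies in \<open>AM \<inter> B\<close>, hence in
  \<open>A\<close>. Geometrically, a line from a coset of \<open>B\<close> and a line from a coset
  of \<open>AM\<close> share at most one affine point.\<close>

lemma A_eq_of_B_AM_eq:
  assumes "x \<in> carrier G" "y \<in> carrier G" "x <# B = y <# B" "x <# AM = y <# AM"
  shows "x <# A = y <# A"
  using assms AM_Int_B by (simp add: lcos_eq_iff A B AM) blast

text \<open>Two points on two common lines, where each element \<open>p\<close>, \<open>q\<close>,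
  \<open>r\<close>, \<open>s\<close> stands for an incident pair. Going from \<open>p\<close> to
  \<open>r\<close> through \<open>q\<close> puts \<open>inv p \<otimes> r\<close> into
  \<open>BA\<close>, going through \<open>s\<close> puts it into \<open>AB\<close>, so it lies in
  \<open>A \<union> B\<close>.\<close>

lemma no_proper_quadrilateral:
  assumes c: "p \<in> carrier G" "q \<in> carrier G" "r \<in> carrier G" "s \<in> carrier G"
    and *: "p <# B = q <# B" "q <# A = r <# A" "r <# B = s <# B" "s <# A = p <# A"
  shows "p <# A = q <# A \<or> q <# B = r <# B"
proof -
  have mem: "inv p \<otimes> q \<in> B" "inv q \<otimes> r \<in> A" "inv p \<otimes> s \<in> A" "inv s \<otimes> r \<in> B"
    using * c by (metis lcos_eq_iff A B)+
  have "inv p \<otimes> r = (inv p \<otimes> q) \<otimes> (inv q \<otimes> r)" "inv p \<otimes> r = (inv p \<otimes> s) \<otimes> (inv s \<otimes> r)"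
    using c by (simp_all add: m_assoc mult_inv_cancel)
  then have "inv p \<otimes> r \<in> B <#> A" "inv p \<otimes> r \<in> A <#> B"
    using mem set_multI by metis+
  then have "inv p \<otimes> r \<in> A \<union> B"
    using AB_BA by blast
  then have "p <# A = r <# A \<or> p <# B = r <# B"
    using c by (simp add: lcos_eq_iff A B)
  then show ?thesis
    using * by auto
qed

lemma AM_eq_or_joined:
  assumes c: "x \<in> carrier G" "y \<in> carrier G"
  shows "x <# AM = y <# AM \<or>
    (\<exists>p\<in>carrier G. \<exists>q\<in>carrier G. p <# A = x <# A \<and> p <# B = q <# B \<and> q <# A = y <# A)"
proof (cases "inv x \<otimes> y \<in> AM")
  case True
  then show ?thesis
    using c by (simp add: lcos_eq_iff AM)
next
  case False
  moreover have "inv x \<otimes> y \<in> carrier G"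
    using c by simp
  ultimately have "inv x \<otimes> y \<in> ((A <#> B) - A) <#> A"
    using carrier_cover by blast
  then obtain a b a' where *: "a \<in> A" "b \<in> B" "a' \<in> A" "inv x \<otimes> y = a \<otimes> b \<otimes> a'"
    unfolding set_mult_def by blast
  have ac: "a \<in> carrier G" "b \<in> carrier G" "a' \<in> carrier G"
    using * A B by (auto dest: subgroup.mem_carrier)
  have y: "y = x \<otimes> (a \<otimes> b \<otimes> a')"
    using * c ac by (metis inv_solve_left m_closed inv_closed)
  \<comment> \<open>The factorization \<open>y = x a b a'\<close> is a path from \<open>x\<close> to
    \<open>y\<close>: its first and last steps stay in a coset of \<open>A\<close>, its middle step
    in a coset of \<open>B\<close>. The two intermediate elements are the witnesses.\<close>
  have "(x \<otimes> a) <# A = x <# A" "(x \<otimes> a) <# B = (x \<otimes> a \<otimes> b) <# B" "(x \<otimes> a \<otimes> b) <# A = y <# A"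
    using * ac c y
    by (simp_all add: lcos_eq_iff A B m_assoc inv_mult_group subgroup.m_inv_closed)
       (simp_all add: m_assoc[symmetric] subgroup.m_inv_closed A)
  then show ?thesis
    using ac c by blast
qed

text \<open>Since \<open>G = (BM)A\<close>, one can write \<open>inv y \<otimes> x = v a\<close>;
  then \<open>x (inv a) = y v\<close> lies in both cosets. This will join an affine point to an
  ideal point.\<close>

lemma A_meets_BM:
  assumes c: "x \<in> carrier G" "y \<in> carrier G"
  shows "\<exists>p\<in>carrier G. p <# A = x <# A \<and> p <# BM = y <# BM"
proof -
  have "inv y \<otimes> x \<in> BM <#> A"
    using c soft_triple.carrier_eq[OF swap] by auto
  then obtain v a where *: "v \<in> BM" "a \<in> A" "inv y \<otimes> x = v \<otimes> a"
    unfolding set_mult_def[of _ _ A] by blast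
  have ac: "v \<in> carrier G" "a \<in> carrier G"
    using * A BM by (auto dest: subgroup.mem_carrier)
  have v: "v = inv y \<otimes> (x \<otimes> inv a)"
    using * c ac by (metis inv_solve_right m_assoc inv_closed m_closed)
  have "y <# BM = (x \<otimes> inv a) <# BM"
    using c ac * v by (simp add: lcos_eq_iff BM)
  moreover have "x <# A = (x \<otimes> inv a) <# A"
    using c ac * by (simp add: lcos_eq_iff A m_assoc[symmetric] subgroup.m_inv_closed)
  ultimately show ?thesis
    using c ac by (metis inv_closed m_closed)
qed

text \<open>Exchanging \<open>A\<close> and \<open>B\<close> exchanges affine points with lines from
  cosets of \<open>B\<close>, and ideal points with lines from cosets of \<open>AM\<close>. So facts
  about joining points become facts about meeting lines.\<close>

lemmas BM_eq_of_B_eq = soft_triple.AM_eq_of_A_eq[OF swap]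
  and B_eq_of_A_BM_eq = soft_triple.A_eq_of_B_AM_eq[OF swap]
  and BM_eq_or_meeting = soft_triple.AM_eq_or_joined[OF swap]
  and B_meets_AM = soft_triple.A_meets_BM[OF swap]

section \<open>The coset geometry: points, lines and incidence\<close>

definition points :: "'a set set" where
  "points = (\<lambda>x. x <# A) ` carrier G \<union> (\<lambda>x. x <# BM) ` carrier G \<union> {carrier G}"

definition line_B :: "'a \<Rightarrow> 'a set set" where
  "line_B h = (\<lambda>x. x <# A) ` (h <# B) \<union> {h <# BM}"

definition line_AM :: "'a \<Rightarrow> 'a set set" where
  "line_AM g = (\<lambda>x. x <# A) ` (g <# AM) \<union> {carrier G}"

definition line_inf :: "'a set set" where
  "line_inf = (\<lambda>x. x <# BM) ` carrier G \<union> {carrier G}"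

definition lines :: "'a set set set" where
  "lines = line_B ` carrier G \<union> line_AM ` carrier G \<union> {line_inf}"

lemma points_cases:
  assumes "c \<in> points"
  obtains (affine) x where "x \<in> carrier G" "c = x <# A"
    | (ideal) x where "x \<in> carrier G" "c = x <# BM"
    | (base) "c = carrier G"
  using assms unfolding points_def by blast

lemma in_points: "x \<in> carrier G \<Longrightarrow> x <# A \<in> points"
    "x \<in> carrier G \<Longrightarrow> x <# BM \<in> points" "carrier G \<in> points"
  by (simp_all add: points_def)

lemma lines_cases:
  assumes "l \<in> lines"
  obtains (via_B) h where "h \<in> carrier G" "l = line_B h"
    | (via_AM) g where "g \<in> carrier G" "l = line_AM g"
    | (inf) "l = line_inf"
  using assms unfolding lines_def by blast

text \<open>All points are subsets of the group, so the three kinds might overlap; their sizes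
  \<open>nk\<close>, \<open>n\<^sup>2 k\<close> and \<open>n\<^sup>3 k\<close> keep them
  apart.\<close>

lemma point_types_distinct:
  assumes "x \<in> carrier G" "y \<in> carrier G"
  shows "x <# A \<noteq> y <# BM" "x <# A \<noteq> carrier G" "y <# BM \<noteq> carrier G"
proof -
  have "card (x <# A) = n * k" "card (y <# BM) = n\<^sup>2 * k"
    using assms card_lcos subgroup.subset A BM card_A card_BM by metis+
  moreover have "n * k < n\<^sup>2 * k" "n\<^sup>2 * k < n ^ 3 * k"
    using n k_pos by (simp_all add: power2_eq_square power3_eq_cube)
  ultimately show "x <# A \<noteq> y <# BM" "x <# A \<noteq> carrier G" "y <# BM \<noteq> carrier G"
    using card_G by auto
qed

text \<open>Translates incidence into equations between cosets, the form in which the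
  group-theoretic lemmas apply. An affine point and a line from a coset of \<open>B\<close> are
  incident when one element \<open>p\<close> represents both cosets.\<close>

lemma incidence:
  assumes "x \<in> carrier G" "h \<in> carrier G"
  shows "x <# A \<in> line_B h \<longleftrightarrow> (\<exists>p\<in>carrier G. p <# A = x <# A \<and> p <# B = h <# B)"
    and "x <# BM \<in> line_B h \<longleftrightarrow> x <# BM = h <# BM"
    and "carrier G \<notin> line_B h"
    and "x <# A \<in> line_AM h \<longleftrightarrow> x <# AM = h <# AM"
    and "x <# BM \<notin> line_AM h"
    and "carrier G \<in> line_AM h"
    and "x <# A \<notin> line_inf"
    and "x <# BM \<in> line_inf"
    and "carrier G \<in> line_inf"
proof -
  have sub: "h <# B \<subseteq> carrier G" "h <# AM \<subseteq> carrier G"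
    using assms lcos_subset_carrier B AM by blast+
  have not_affine: "x <# BM \<notin> (\<lambda>x. x <# A) ` S" "carrier G \<notin> (\<lambda>x. x <# A) ` S"
    if "S \<subseteq> carrier G" for S
    using that assms point_types_distinct(1)[OF _ assms(1)] point_types_distinct(2)[OF _ assms(1)]
    by blast+
  show "x <# A \<in> line_B h \<longleftrightarrow> (\<exists>p\<in>carrier G. p <# A = x <# A \<and> p <# B = h <# B)"
    using assms point_types_distinct unfolding line_B_def by (auto simp: mem_lcos_iff B)
  show "x <# A \<in> line_AM h \<longleftrightarrow> x <# AM = h <# AM"
  proof -
    have "x <# A \<in> line_AM h \<longleftrightarrow> (\<exists>p\<in>carrier G. x <# A = p <# A \<and> h <# AM = p <# AM)"
      using assms point_types_distinct unfolding line_AM_def by (auto simp: mem_lcos_iff AM)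
    then show ?thesis
      using assms AM_eq_of_A_eq by metis
  qed
  show "x <# BM \<in> line_B h \<longleftrightarrow> x <# BM = h <# BM" "carrier G \<notin> line_B h"
    "x <# BM \<notin> line_AM h"
    using assms not_affine[OF sub(1)] not_affine[OF sub(2)] point_types_distinct(3)[of x h]
      point_types_distinct(3)[of h h] point_types_distinct(3)[of x x]
    unfolding line_B_def line_AM_def by auto
  show "x <# A \<notin> line_inf"
    using assms point_types_distinct unfolding line_inf_def by auto
qed (use assms in \<open>auto simp: line_AM_def line_inf_def\<close>)

lemma line_B_cong:
  "\<lbrakk>x \<in> carrier G; y \<in> carrier G; x <# B = y <# B\<rbrakk> \<Longrightarrow> line_B x = line_B y"
  using BM_eq_of_B_eq unfolding line_B_def by metis

lemma line_B_in_lines: "h \<in> carrier G \<Longrightarrow> line_B h \<in> lines"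
  and line_AM_in_lines: "g \<in> carrier G \<Longrightarrow> line_AM g \<in> lines"
  and line_inf_in_lines: "line_inf \<in> lines"
  by (auto simp: lines_def)

lemma lines_subset_points:
  assumes "l \<in> lines"
  shows "l \<subseteq> points"
  using assms
proof (cases rule: lines_cases)
  case (via_B h)
  then show ?thesis
    using lcos_subset_carrier[OF B] unfolding points_def line_B_def by blast
next
  case (via_AM g)
  then show ?thesis
    using lcos_subset_carrier[OF AM] unfolding points_def line_AM_def by blast
next
  case inf
  then show ?thesis
    unfolding points_def line_inf_def by blast
qed

section \<open>Two points are joined by exactly one line\<close>

lemma join_exists:
  assumes "c \<in> points" "d \<in> points"
  shows "\<exists>l\<in>lines. c \<in> l \<and> d \<in> l"
proof -
  have AA: "\<exists>l\<in>lines. x <# A \<in> l \<and> y <# A \<in> l" if c: "x \<in> carrier G" "y \<in> carrier G" for x y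
    using AM_eq_or_joined[OF c]
  proof (elim disjE bexE conjE)
    assume "x <# AM = y <# AM"
    then show ?thesis
      using c incidence(4)[OF c(1) c(1)] incidence(4)[OF c(2) c(1)] line_AM_in_lines by metis
  next
    fix p q assume p: "p \<in> carrier G" and "q \<in> carrier G" "p <# A = x <# A" "p <# B = q <# B" "q <# A = y <# A"
    then have "x <# A \<in> line_B p" "y <# A \<in> line_B p"
      using incidence(1)[OF c(1) p] incidence(1)[OF c(2) p] by metis+
    then show ?thesis
      using p line_B_in_lines by blast
  qed
  have AI: "\<exists>l\<in>lines. x <# A \<in> l \<and> y <# BM \<in> l" if c: "x \<in> carrier G" "y \<in> carrier G" for x y
  proof -
    obtain p where p: "p \<in> carrier G" "p <# A = x <# A" "p <# BM = y <# BM"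
      using A_meets_BM[OF c] by blast
    then have "x <# A \<in> line_B p" "y <# BM \<in> line_B p"
      using incidence(1)[OF c(1) p(1)] incidence(2)[OF c(2) p(1)] by metis+
    then show ?thesis
      using p line_B_in_lines by blast
  qed
  have AC: "\<exists>l\<in>lines. x <# A \<in> l \<and> carrier G \<in> l" if "x \<in> carrier G" for x
    using incidence(4,6)[OF that that] line_AM_in_lines[OF that] by blast
  have I: "\<exists>l\<in>lines. c \<in> l \<and> d \<in> l" if "c \<in> line_inf" "d \<in> line_inf"
    using that line_inf_in_lines by blast
  show ?thesis
    using assms
  proof (cases rule: points_cases[case_product points_cases])
    case (affine_affine x y)
    then show ?thesis using AA[of x y] by simp
  next
    case (affine_ideal x y)
    then show ?thesis using AI[of x y] by simp
  next
    case (affine_base x)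
    then show ?thesis using AC[of x] by simp
  next
    case (ideal_affine x y)
    then show ?thesis using AI[of y x] by (simp add: conj_commute)
  next
    case (base_affine x)
    then show ?thesis using AC[of x] by (simp add: conj_commute)
  \<comment> \<open>In the remaining cases neither point is affine, so the line at infinity contains
    both.\<close>
  qed (rule I; simp add: line_inf_def)+
qed

lemma line_eq_affine_affine:
  assumes c: "x \<in> carrier G" "y \<in> carrier G" "x <# A \<noteq> y <# A"
    and l: "l \<in> lines" "x <# A \<in> l" "y <# A \<in> l"
    and m: "m \<in> lines" "x <# A \<in> m" "y <# A \<in> m"
  shows "l = m"
proof -
  \<comment> \<open>The four incidences of two points with two lines yield the representatives
    \<open>p\<close>, \<open>q\<close>, \<open>r\<close>, \<open>s\<close> of a quadrilateral. As
    the points differ, the lines must agree.\<close>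
  have BB: "line_B h = line_B h'" if h: "h \<in> carrier G" "h' \<in> carrier G"
    "x <# A \<in> line_B h" "y <# A \<in> line_B h" "x <# A \<in> line_B h'" "y <# A \<in> line_B h'" for h h'
  proof -
    obtain p where p: "p \<in> carrier G" "p <# A = x <# A" "p <# B = h <# B"
      using incidence(1)[OF c(1) h(1)] h by blast
    obtain q where q: "q \<in> carrier G" "q <# A = y <# A" "q <# B = h <# B"
      using incidence(1)[OF c(2) h(1)] h by blast
    obtain r where r: "r \<in> carrier G" "r <# A = y <# A" "r <# B = h' <# B"
      using incidence(1)[OF c(2) h(2)] h by blast
    obtain s where s: "s \<in> carrier G" "s <# A = x <# A" "s <# B = h' <# B"
      using incidence(1)[OF c(1) h(2)] h by blast
    have "h <# B = h' <# B"
      using no_proper_quadrilateral[of p q r s] c p q r s by metis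
    then show ?thesis
      using h line_B_cong by blast
  qed
  \<comment> \<open>Representatives \<open>p\<close>, \<open>q\<close> of the two points on the
    first line share a coset of \<open>B\<close>, and the second line puts them into the same coset
    of \<open>AM\<close>. So they would share a coset of \<open>A\<close>, and the points would
    coincide.\<close>
  have BA: False if h: "h \<in> carrier G" "g \<in> carrier G"
    "x <# A \<in> line_B h" "y <# A \<in> line_B h" "x <# A \<in> line_AM g" "y <# A \<in> line_AM g" for h g
  proof -
    obtain p where p: "p \<in> carrier G" "p <# A = x <# A" "p <# B = h <# B"
      using incidence(1)[OF c(1) h(1)] h by blast
    obtain q where q: "q \<in> carrier G" "q <# A = y <# A" "q <# B = h <# B"
      using incidence(1)[OF c(2) h(1)] h by blast
    have "p <# AM = x <# AM" "q <# AM = y <# AM"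
      using AM_eq_of_A_eq[OF p(1) c(1) p(2)] AM_eq_of_A_eq[OF q(1) c(2) q(2)] by simp_all
    then have "p <# AM = q <# AM"
      using incidence(4)[OF c(1) h(2)] incidence(4)[OF c(2) h(2)] h by simp
    then show False
      using A_eq_of_B_AM_eq[of p q] p q c by simp
  qed
  have AA: "line_AM g = line_AM g'" if "g \<in> carrier G" "g' \<in> carrier G"
    "x <# A \<in> line_AM g" "x <# A \<in> line_AM g'" for g g'
    using that incidence(4)[OF c(1), of g] incidence(4)[OF c(1), of g'] by (simp add: line_AM_def)
  have I: "x <# A \<notin> line_inf"
    using incidence(7)[OF c(1) c(1)] .
  show ?thesis
    using l(1) m(1)
  proof (cases rule: lines_cases[case_product lines_cases])
    case (via_B_via_B h h')
    then show ?thesis using BB[of h h'] l m by simp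
  next
    case (via_B_via_AM h g)
    then show ?thesis using BA[of h g] l m by simp
  next
    case (via_AM_via_B g h)
    then show ?thesis using BA[of h g] l m by simp
  next
    case (via_AM_via_AM g g')
    then show ?thesis using AA[of g g'] l m by simp
  qed (use I l m in auto)
qed

text \<open>Such a line is \<open>line_B p\<close> for some \<open>p\<close> in
  \<open>x <# A\<close> with \<open>p <# BM = y <# BM\<close>. By the dual of
  \<open>A_eq_of_B_AM_eq\<close>, these two cosets determine \<open>p <# B\<close>, hence the
  line.\<close>

lemma line_eq_affine_ideal:
  assumes c: "x \<in> carrier G" "y \<in> carrier G"
    and l: "l \<in> lines" "x <# A \<in> l" "y <# BM \<in> l"
    and m: "m \<in> lines" "x <# A \<in> m" "y <# BM \<in> m"
  shows "l = m"
proof -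
  have type: "\<exists>p\<in>carrier G. l = line_B p \<and> p <# A = x <# A \<and> p <# BM = y <# BM"
    if l: "l \<in> lines" "x <# A \<in> l" "y <# BM \<in> l" for l
    using l(1)
  proof (cases rule: lines_cases)
    case (via_B h)
    then obtain p where "p \<in> carrier G" "p <# A = x <# A" "p <# B = h <# B"
      using l incidence(1)[OF c(1) via_B(1)] by blast
    moreover have "y <# BM = h <# BM"
      using via_B l incidence(2)[OF c(2) via_B(1)] by simp
    ultimately show ?thesis
      using via_B line_B_cong[of p h] BM_eq_of_B_eq[of p h] by auto
  next
    case (via_AM g)
    then show ?thesis
      using l incidence(5)[OF c(2) via_AM(1)] by simp
  next
    case inf
    then show ?thesis
      using l incidence(7)[OF c(1) c(1)] by simp
  qed
  obtain p q where "p \<in> carrier G" "q \<in> carrier G" "l = line_B p" "m = line_B q"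
    "p <# A = x <# A" "p <# BM = y <# BM" "q <# A = x <# A" "q <# BM = y <# BM"
    using type[OF l] type[OF m] by blast
  then show ?thesis
    using B_eq_of_A_BM_eq[of p q] line_B_cong by metis
qed

lemma line_eq_affine_base:
  assumes c: "x \<in> carrier G" and l: "l \<in> lines" "x <# A \<in> l" "carrier G \<in> l"
  shows "l = line_AM x"
  using l(1)
proof (cases rule: lines_cases)
  case (via_B h)
  then show ?thesis using l incidence(3)[OF c via_B(1)] by simp
next
  case (via_AM g)
  then show ?thesis using l incidence(4)[OF c via_AM(1)] by (simp add: line_AM_def)
next
  case inf
  then show ?thesis using l incidence(7)[OF c c] by simp
qed

lemma line_eq_ideal_ideal:
  assumes c: "x \<in> carrier G" "y \<in> carrier G" "x <# BM \<noteq> y <# BM"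
    and l: "l \<in> lines" "x <# BM \<in> l" "y <# BM \<in> l"
  shows "l = line_inf"
  using l(1)
  by (cases rule: lines_cases) (use l c(3) incidence(2,5)[OF c(1)] incidence(2,5)[OF c(2)] in auto)

lemma line_eq_ideal_base:
  assumes c: "x \<in> carrier G" and l: "l \<in> lines" "x <# BM \<in> l" "carrier G \<in> l"
  shows "l = line_inf"
  using l(1)
  by (cases rule: lines_cases) (use l incidence(3,5)[OF c] in auto)

lemma join_unique:
  assumes "c \<noteq> d" "l \<in> lines" "c \<in> l" "d \<in> l" "m \<in> lines" "c \<in> m" "d \<in> m"
  shows "l = m"
proof -
  have "c \<in> points" "d \<in> points"
    using assms lines_subset_points by blast+
  then show ?thesis
  proof (cases rule: points_cases[case_product points_cases])
    case (affine_affine x y)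
    then show ?thesis using line_eq_affine_affine[of x y l m] assms by simp
  next
    case (affine_ideal x y)
    then show ?thesis using line_eq_affine_ideal[of x y l m] assms by simp
  next
    case (affine_base x)
    then show ?thesis using line_eq_affine_base[of x l] line_eq_affine_base[of x m] assms by simp
  next
    case (ideal_affine x y)
    then show ?thesis using line_eq_affine_ideal[of y x l m] assms by simp
  next
    case (ideal_ideal x y)
    then show ?thesis using line_eq_ideal_ideal[of x y l] line_eq_ideal_ideal[of x y m] assms by simp
  next
    case (ideal_base x)
    then show ?thesis using line_eq_ideal_base[of x l] line_eq_ideal_base[of x m] assms by simp
  next
    case (base_affine x)
    then show ?thesis using line_eq_affine_base[of x l] line_eq_affine_base[of x m] assms by simp
  next
    case (base_ideal x)
    then show ?thesis using line_eq_ideal_base[of x l] line_eq_ideal_base[of x m] assms by simp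
  next
    case base_base
    then show ?thesis using assms by simp
  qed
qed

section \<open>Meeting points, a quadrangle, and the projective plane axioms\<close>

lemma meet_exists:
  assumes "l \<in> lines" "m \<in> lines"
  shows "\<exists>c. c \<in> l \<and> c \<in> m"
proof -
  have BB: "\<exists>c. c \<in> line_B h \<and> c \<in> line_B h'" if c: "h \<in> carrier G" "h' \<in> carrier G" for h h'
    using BM_eq_or_meeting[OF c]
  proof (elim disjE bexE conjE)
    assume "h <# BM = h' <# BM"
    then show ?thesis
      using incidence(2)[OF c(1) c(1)] incidence(2)[OF c(1) c(2)] by blast
  next
    fix p q assume p: "p \<in> carrier G" and "q \<in> carrier G" "p <# B = h <# B" "p <# A = q <# A" "q <# B = h' <# B"
    then have "p <# A \<in> line_B h" "p <# A \<in> line_B h'"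
      using incidence(1)[OF p c(1)] incidence(1)[OF p c(2)] by metis+
    then show ?thesis
      by blast
  qed
  have BA: "\<exists>c. c \<in> line_B h \<and> c \<in> line_AM g" if c: "h \<in> carrier G" "g \<in> carrier G" for h g
  proof -
    obtain p where p: "p \<in> carrier G" "p <# B = h <# B" "p <# AM = g <# AM"
      using B_meets_AM[OF c] by blast
    then have "p <# A \<in> line_B h" "p <# A \<in> line_AM g"
      using incidence(1)[OF p(1) c(1)] incidence(4)[OF p(1) c(2)] by metis+
    then show ?thesis
      by blast
  qed
  have BI: "\<exists>c. c \<in> line_B h \<and> c \<in> line_inf" if c: "h \<in> carrier G" for h
    using c by (auto simp: line_B_def line_inf_def)
  show ?thesis
    using assms
  proof (cases rule: lines_cases[case_product lines_cases])
    case (via_B_via_B h h')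
    then show ?thesis using BB by simp
  next
    case (via_B_via_AM h g)
    then show ?thesis using BA by simp
  next
    case (via_AM_via_B g h)
    then show ?thesis using BA[of h g] by blast
  next
    case (via_B_inf h)
    then show ?thesis using BI by simp
  next
    case (inf_via_B h)
    then show ?thesis using BI[of h] by blast
  \<comment> \<open>The remaining pairs consist of lines through the base point.\<close>
  qed (auto simp: line_AM_def line_inf_def)
qed

lemma quadrangle_exists: "\<exists>Q. Q \<subseteq> points \<and> card Q = 4 \<and> (\<forall>l\<in>lines. card (Q \<inter> l) \<le> 2)"
proof -
  have card_BA: "card (B <#> A) = n\<^sup>2 * k"
    using soft_triple.card_AB[OF swap] .
  have BA: "B <#> A \<subseteq> carrier G"
    using set_mult_closed subgroup.subset A B by metis
  \<comment> \<open>The common element makes the bound on the union strict: it has fewer than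
    \<open>2 n\<^sup>2 k\<close> elements, which leaves an element outside even when
    \<open>n = 2\<close>.\<close>
  have one: "\<one> \<in> AM \<inter> (B <#> A)"
    using subgroup.one_closed[OF AM] subgroup.one_closed[OF A]
      subset_set_mult[OF subgroup.subset[OF B] A] subgroup.one_closed[OF B] by blast
  have f: "finite AM" "finite (B <#> A)"
    using finite_subset[OF _ fin] BA subgroup.subset[OF AM] by blast+
  have "card (AM \<union> (B <#> A)) + card (AM \<inter> (B <#> A)) = 2 * (n\<^sup>2 * k)"
    using card_Un_Int[OF f] card_BA card_AM by simp
  moreover have "card (AM \<inter> (B <#> A)) > 0"
    using one f by (auto simp: card_gt_0_iff)
  moreover have "2 * (n\<^sup>2 * k) \<le> n * (n\<^sup>2 * k)"
    using n by (intro mult_right_mono) auto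
  moreover have "n * (n\<^sup>2 * k) = card (carrier G)"
    unfolding card_G by (simp add: power2_eq_square power3_eq_cube)
  ultimately have "card (AM \<union> (B <#> A)) < card (carrier G)"
    by linarith
  then have "\<not> carrier G \<subseteq> AM \<union> (B <#> A)"
    using f card_mono[of "AM \<union> (B <#> A)" "carrier G"] by auto
  then obtain y where y: "y \<in> carrier G" "y \<notin> AM" "y \<notin> B <#> A"
    by blast
  have AM': "\<one> <# AM \<noteq> y <# AM"
    using y by (simp add: lcos_eq_iff AM)
  then have A': "\<one> <# A \<noteq> y <# A"
    using y AM_eq_of_A_eq by blast
  \<comment> \<open>The base point and \<open>\<one> <# BM\<close> span the line at infinity, which
    has no affine points. As \<open>y\<close> is outside \<open>AM\<close>, the base point is not
    collinear with the two affine points; as \<open>y\<close> is outside \<open>BA\<close>, the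
    ideal point is not either.\<close>
  let ?Q = "{carrier G, \<one> <# BM, \<one> <# A, y <# A}"
  have "?Q \<subseteq> points"
    using y by (auto simp: points_def)
  moreover have "card ?Q = 4"
    using A' y point_types_distinct[of \<one> \<one>] point_types_distinct[of y \<one>] by auto
  moreover have "card (?Q \<inter> l) \<le> 2" if l: "l \<in> lines" for l
  proof -
    have "\<exists>c d. ?Q \<inter> l \<subseteq> {c, d}"
      using l
    proof (cases rule: lines_cases)
      case (via_B h)
      have "\<not> (\<one> <# BM \<in> l \<and> \<one> <# A \<in> l \<and> y <# A \<in> l)"
      proof
        assume *: "\<one> <# BM \<in> l \<and> \<one> <# A \<in> l \<and> y <# A \<in> l"
        then obtain p q where **: "p \<in> carrier G" "p <# A = \<one> <# A" "p <# B = h <# B"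
          "q \<in> carrier G" "q <# A = y <# A" "q <# B = h <# B"
          using via_B incidence(1)[OF one_closed via_B(1)] incidence(1)[OF y(1) via_B(1)] by blast
        have "\<one> <# BM = h <# BM"
          using * via_B incidence(2)[OF one_closed via_B(1)] by simp
        then have "p <# BM = \<one> <# BM"
          using ** via_B BM_eq_of_B_eq[of p h] by simp
        \<comment> \<open>The line through \<open>\<one> <# A\<close> and
          \<open>\<one> <# BM\<close> can only come from \<open>B\<close> itself. A point
          \<open>y <# A\<close> on it has a representative \<open>q\<close> in \<open>B\<close>, so
          \<open>y\<close> would lie in \<open>BA\<close>.\<close>
        then have "\<one> <# B = q <# B"
          using ** B_eq_of_A_BM_eq[of p \<one>] by simp
        then have "q \<in> B"
          using **(4) lcos_eq_iff[OF B, of \<one> q] by simp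
        moreover have "inv q \<otimes> y \<in> A"
          using ** y lcos_eq_iff[OF A, of q y] by simp
        ultimately have "q \<otimes> (inv q \<otimes> y) \<in> B <#> A"
          by (rule set_multI)
        then show False
          using ** y by (simp add: m_assoc[symmetric])
      qed
      moreover have "carrier G \<notin> l"
        using via_B incidence(3)[OF via_B(1) via_B(1)] by simp
      ultimately show ?thesis
        by blast
    next
      case (via_AM g)
      then have "\<one> <# BM \<notin> l" "\<not> (\<one> <# A \<in> l \<and> y <# A \<in> l)"
        using AM' incidence(4,5)[OF one_closed via_AM(1)] incidence(4)[OF y(1) via_AM(1)] by auto
      then show ?thesis
        by blast
    next
      case inf
      then have "\<one> <# A \<notin> l" "y <# A \<notin> l"
        using y incidence(7) by auto
      then show ?thesis
        by blast
    qed
    then obtain c d where "?Q \<inter> l \<subseteq> {c, d}"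
      by (elim exE)
    then have "card (?Q \<inter> l) \<le> card {c, d}"
      by (rule card_mono[rotated]) simp
    also have "\<dots> \<le> 2"
      by (simp add: card_insert_if)
    finally show ?thesis .
  qed
  ultimately show ?thesis
    by blast
qed

lemma projective_plane: "projective_plane points lines"
proof
  show "\<exists>!l. l \<in> lines \<and> c \<in> l \<and> d \<in> l" if "c \<in> points" "d \<in> points" "c \<noteq> d" for c d
    using join_exists[OF that(1,2)] join_unique[OF that(3)] by blast
  show "\<exists>!c. c \<in> l \<and> c \<in> m" if "l \<in> lines" "m \<in> lines" "l \<noteq> m" for l m
    \<comment> \<open>Two common points of \<open>l\<close> and \<open>m\<close> would make the
      lines equal, by uniqueness of the joining line.\<close>
    using meet_exists[OF that(1,2)] join_unique that by metis
  show "l \<subseteq> points" if "l \<in> lines" for l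
    using that by (rule lines_subset_points)
qed (rule quadrangle_exists)

section \<open>The order of the plane\<close>

text \<open>Apart from one extra point, each line is a family of cosets filling a set of known size.
  For the lines with affine points, \<open>n\<^sup>2 k\<close> elements are divided into cosets of
  size \<open>nk\<close>; for the line at infinity, \<open>n\<^sup>3 k\<close> elements into cosets
  of size \<open>n\<^sup>2 k\<close>. Both quotients are \<open>n\<close>.\<close>

lemma card_line:
  assumes "l \<in> lines"
  shows "card l = n + 1"
proof -
  have count: "card ((\<lambda>x. x <# A) ` S) = n"
    if "S \<subseteq> carrier G" "card (S <#> A) = n\<^sup>2 * k" for S
    using card_lcosets_meeting[OF fin A that(1)] that(2) card_A n k_pos
    by (simp add: power2_eq_square)
  have fi: "finite (f ` (g <# H))" if "subgroup H G" "g \<in> carrier G" for H g and f :: "'a \<Rightarrow> 'a set"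
    using l_coset_subset_G[OF subgroup.subset] that fin by (meson finite_imageI finite_subset)
  show ?thesis
    using assms
  proof (cases rule: lines_cases)
    case (via_B h)
    have sub: "h <# B \<subseteq> carrier G"
      using l_coset_subset_G subgroup.subset B via_B by metis
    have "(h <# B) <#> A = h <# (B <#> A)"
      using setmult_lcos_assoc subgroup.subset A B via_B by metis
    then have "card ((h <# B) <#> A) = n\<^sup>2 * k"
      using card_lcos[of "B <#> A" h] soft_triple.card_AB[OF swap] via_B
        set_mult_closed[OF subgroup.subset[OF B] subgroup.subset[OF A]] by simp
    then have "card ((\<lambda>x. x <# A) ` (h <# B)) = n"
      using count sub by blast
    moreover have "h <# BM \<notin> (\<lambda>x. x <# A) ` (h <# B)"
      using point_types_distinct(1) via_B sub by blast
    ultimately show ?thesis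
      using via_B fi[OF B] by (simp add: line_B_def)
  next
    case (via_AM g)
    have sub: "g <# AM \<subseteq> carrier G"
      using l_coset_subset_G subgroup.subset AM via_AM by metis
    have "(g <# AM) <#> A = g <# (AM <#> A)"
      using setmult_lcos_assoc subgroup.subset A AM via_AM by metis
    also have "AM <#> A = AM"
      using subset_set_mult[OF subgroup.subset[OF AM] A] A_subset_AM
        subgroup.m_closed[OF AM] unfolding set_mult_def[of _ _ A] by blast
    finally have "card ((g <# AM) <#> A) = n\<^sup>2 * k"
      using card_lcos[OF subgroup.subset[OF AM]] card_AM via_AM by simp
    then have "card ((\<lambda>x. x <# A) ` (g <# AM)) = n"
      using count sub by blast
    moreover have "carrier G \<notin> (\<lambda>x. x <# A) ` (g <# AM)"
      using point_types_distinct(2) sub by blast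
    ultimately show ?thesis
      using via_AM fi[OF AM] by (simp add: line_AM_def)
  next
    case inf
    have "carrier G <#> BM = carrier G"
      using subset_set_mult[OF subset_refl BM] set_mult_closed[OF subset_refl subgroup.subset[OF BM]]
      by blast
    then have "card ((\<lambda>x. x <# BM) ` carrier G) * (n\<^sup>2 * k) = n * (n\<^sup>2 * k)"
      using card_lcosets_meeting[OF fin BM subset_refl] card_G card_BM
      by (auto simp: power2_eq_square power3_eq_cube)
    then have "card ((\<lambda>x. x <# BM) ` carrier G) = n"
      using n k_pos by simp
    moreover have "carrier G \<notin> (\<lambda>x. x <# BM) ` carrier G"
      using point_types_distinct(3) by blast
    ultimately show ?thesis
      using inf fin by (simp add: line_inf_def)
  qed
qed

section \<open>The action of the group by left translation\<close>

text \<open>Translation is restricted to \<open>points\<close> because members of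
  \<open>Bij points\<close> have to be extensional.\<close>

definition act :: "'a \<Rightarrow> 'a set \<Rightarrow> 'a set" where
  "act g = (\<lambda>c\<in>points. g <# c)"

lemma lcos_carrier:
  assumes "g \<in> carrier G"
  shows "g <# carrier G = carrier G"
  using coset_join3[OF assms subgroup_self assms] .

lemma lcos_lcos:
  assumes "g \<in> carrier G" "x \<in> carrier G"
  shows "g <# (x <# A) = (g \<otimes> x) <# A" "g <# (x <# B) = (g \<otimes> x) <# B"
    "g <# (x <# AM) = (g \<otimes> x) <# AM" "g <# (x <# BM) = (g \<otimes> x) <# BM"
  using assms A B AM BM by (simp_all add: lcos_m_assoc subgroup.subset)

lemma points_subset_carrier:
  assumes "c \<in> points"
  shows "c \<subseteq> carrier G"
  using assms
  by (cases rule: points_cases) (simp_all add: lcos_subset_carrier A BM)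

lemma act_closed:
  assumes "g \<in> carrier G" "c \<in> points"
  shows "act g c \<in> points"
  using assms(2)
  by (cases rule: points_cases) (simp_all add: assms(1) act_def lcos_lcos lcos_carrier in_points)

lemma act_mult:
  assumes "g \<in> carrier G" "h \<in> carrier G" "c \<in> points"
  shows "act (g \<otimes> h) c = act g (act h c)"
  using assms act_closed[OF assms(2,3)] points_subset_carrier[OF assms(3)]
  by (simp add: act_def lcos_m_assoc)

lemma act_one: "c \<in> points \<Longrightarrow> act \<one> c = c"
  by (simp add: act_def lcos_mult_one points_subset_carrier)

lemma act_line:
  assumes g: "g \<in> carrier G"
  shows "h \<in> carrier G \<Longrightarrow> act g ` line_B h = line_B (g \<otimes> h)"
    and "h \<in> carrier G \<Longrightarrow> act g ` line_AM h = line_AM (g \<otimes> h)"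
    and "act g ` line_inf = line_inf"
proof -
  have restr: "act g ` l = (\<lambda>c. g <# c) ` l" if "l \<in> lines" for l
    using lines_subset_points[OF that] by (auto simp: act_def)
  have lcos: "x <# H = (\<lambda>y. x \<otimes> y) ` H" for x H
    by (auto simp: l_coset_def)
  \<comment> \<open>Translating a coset translates its representatives, so the family of cosets
    indexed by \<open>S\<close> becomes the one indexed by \<open>g <# S\<close>.\<close>
  have im: "(\<lambda>c. g <# c) ` (\<lambda>x. x <# K) ` S = (\<lambda>x. x <# K) ` (g <# S)"
    if "S \<subseteq> carrier G" "subgroup K G" for S K
    unfolding image_image lcos[of g S]
    using that g by (intro image_cong) (auto simp: lcos_m_assoc subgroup.subset)
  show "act g ` line_B h = line_B (g \<otimes> h)" if h: "h \<in> carrier G"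
  proof -
    have "h <# B \<subseteq> carrier G"
      using h l_coset_subset_G[OF subgroup.subset[OF B]] by blast
    then show ?thesis
      using h g restr[of "line_B h"] im[OF _ A] by (simp add: line_B_def lcos_lcos lines_def)
  qed
  show "act g ` line_AM h = line_AM (g \<otimes> h)" if h: "h \<in> carrier G"
  proof -
    have "h <# AM \<subseteq> carrier G"
      using h l_coset_subset_G[OF subgroup.subset[OF AM]] by blast
    then show ?thesis
      using h g restr[of "line_AM h"] im[OF _ A]
      by (simp add: line_AM_def lcos_lcos lcos_carrier lines_def)
  qed
  show "act g ` line_inf = line_inf"
    using g restr[of line_inf] im[OF subset_refl BM] by (simp add: line_inf_def lcos_carrier lines_def)
qed

text \<open>Translation by \<open>inv g\<close> is a two-sided inverse on the points. It maps lines
  to lines too, which gives surjectivity of \<open>act g\<close> on the set of lines.\<close>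

lemma act_collineation:
  assumes g: "g \<in> carrier G"
  shows "act g \<in> collineations points lines"
proof -
  have inv1: "act (inv g) (act g c) = c" "act g (act (inv g) c) = c" if "c \<in> points" for c
    using act_mult[of "inv g" g c] act_mult[of g "inv g" c] act_one[of c] g that by simp_all
  have "bij_betw (act g) points points"
    by (rule bij_betw_byWitness[where f' = "act (inv g)"]) (use inv1 act_closed g in auto)
  moreover have "act g \<in> extensional points"
    by (simp add: act_def)
  ultimately have "act g \<in> Bij points"
    by (simp add: Bij_def)
  moreover have closed: "act h ` l \<in> lines" if "h \<in> carrier G" "l \<in> lines" for h l
    using that(2) by (cases rule: lines_cases) (use that act_line in \<open>auto simp: lines_def\<close>)
  have "(\<lambda>l. act g ` l) ` lines = lines"
  proof
    show "lines \<subseteq> (\<lambda>l. act g ` l) ` lines"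
    proof
      fix l assume l: "l \<in> lines"
      have "act g ` act (inv g) ` l = l"
        using inv1(2) lines_subset_points[OF l] unfolding image_image by force
      then show "l \<in> (\<lambda>l. act g ` l) ` lines"
        using closed[of "inv g" l] l g by (metis imageI inv_closed)
    qed
  qed (use closed g in blast)
  ultimately show ?thesis
    by (simp add: collineations_def)
qed

lemma acts: "acts_by_collineations G points lines act"
proof -
  have "act (g \<otimes> h) = act g \<otimes>\<^bsub>CollineationGroup points lines\<^esub> act h"
    if "g \<in> carrier G" "h \<in> carrier G" for g h
  proof -
    have "act g \<in> Bij points" "act h \<in> Bij points"
      using that act_collineation by (auto simp: collineations_def)
    moreover have "act (g \<otimes> h) = compose points (act g) (act h)"
    proof
      fix c show "act (g \<otimes> h) c = compose points (act g) (act h) c"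
        \<comment> \<open>Outside \<open>points\<close> both sides are \<open>undefined\<close>
          because of the restriction.\<close>
        using that act_mult[of g h c] by (cases "c \<in> points") (auto simp: compose_def act_def)
    qed
    ultimately show ?thesis
      by (simp add: CollineationGroup_def BijGroup_def)
  qed
  then have "act \<in> hom G (CollineationGroup points lines)"
    using act_collineation by (intro homI) (auto simp: CollineationGroup_def)
  then show ?thesis
    unfolding acts_by_collineations_def
    using projective_plane.group_CollineationGroup[OF projective_plane] is_group
    by (intro group_hom.intro group_hom_axioms.intro)
qed

section \<open>Transitivity on the flags opposite the fixed flag\<close>

lemma base_flag: "(carrier G, line_inf) \<in> flags points lines"
  by (auto simp: flags_def points_def lines_def line_inf_def)

text \<open>Avoiding the line at infinity forces the point to be affine, and avoiding the base point
  forces the line to come from a coset of \<open>B\<close>. Incidence then supplies one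
  \<open>p\<close> representing both, so these flags are parametrized by group elements.\<close>

lemma opposite_flag_cases:
  assumes "(w, W) \<in> flags points lines" "w \<notin> line_inf" "carrier G \<notin> W"
  obtains p where "p \<in> carrier G" "w = p <# A" "W = line_B p"
proof -
  have w: "w \<in> points" "W \<in> lines" "w \<in> W"
    using assms(1) by (auto simp: flags_def)
  obtain x where x: "x \<in> carrier G" "w = x <# A"
    using w(1) assms(2) by (cases rule: points_cases) (auto simp: line_inf_def)
  obtain h where h: "h \<in> carrier G" "W = line_B h"
    using w(2) assms(3) by (cases rule: lines_cases) (auto simp: line_inf_def line_AM_def)
  obtain p where "p \<in> carrier G" "p <# A = x <# A" "p <# B = h <# B"
    using incidence(1)[OF x(1) h(1)] w(3) x h by blast
  then show ?thesis
    using that x h line_B_cong by metis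
qed

lemma soft: "soft_group points lines (act ` carrier G)"
proof -
  have "finite points"
    using fin by (simp add: points_def)
  moreover have "subgroup (act ` carrier G) (CollineationGroup points lines)"
    using acts group_hom.img_is_subgroup unfolding acts_by_collineations_def by blast
  moreover have "act g (carrier G) = carrier G \<and> act g ` line_inf = line_inf"
    if "g \<in> carrier G" for g
    using that act_line(3) by (simp add: act_def in_points lcos_carrier)
  moreover have "\<exists>g\<in>carrier G. act g w = w' \<and> act g ` W = W'"
    if *: "(w, W) \<in> flags points lines" "(w', W') \<in> flags points lines"
      "w \<notin> line_inf" "carrier G \<notin> W" "w' \<notin> line_inf" "carrier G \<notin> W'" for w W w' W'
  proof -
    obtain p where p: "p \<in> carrier G" "w = p <# A" "W = line_B p"
      using opposite_flag_cases *(1,3,4) by blast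
    obtain q where q: "q \<in> carrier G" "w' = q <# A" "W' = line_B q"
      using opposite_flag_cases *(2,5,6) by blast
    \<comment> \<open>On the representing elements the action is left multiplication, so
      \<open>q \<otimes> inv p\<close> carries the flag of \<open>p\<close> to the flag of
      \<open>q\<close>.\<close>
    have "q \<otimes> inv p \<otimes> p = q"
      using p q by (simp add: m_assoc)
    then have "act (q \<otimes> inv p) w = w'" "act (q \<otimes> inv p) ` W = W'"
      using p q act_line(1)[of "q \<otimes> inv p" p] by (simp_all add: act_def in_points lcos_lcos)
    then show ?thesis
      using p q by blast
  qed
  ultimately show ?thesis
    using projective_plane base_flag unfolding soft_group_def
    by (intro conjI bexI[of _ "(carrier G, line_inf)"]) auto
qed

end

theorem theorem2p1:
  fixes G :: "('a, 'b) monoid_scheme" (structure)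
    and A B M :: "'a set" and n k :: nat
  assumes "n > 1"
    and "group G" and "finite (carrier G)"
    and "subgroup A G" and "subgroup B G" and "subgroup M G"
    and "k = card (A \<inter> B)"
    and "card A = n * k" and "card B = n * k" and "card M = n * k"
    and "card (carrier G) = n ^ 3 * k"
    and "subgroup (A <#> M) G" and "card (A <#> M) = n\<^sup>2 * k"
    and "subgroup (B <#> M) G" and "card (B <#> M) = n\<^sup>2 * k"
    and "carrier G = (A <#> M) <#> B"
    and "(A <#> B) \<inter> (B <#> A) = A \<union> B"
  shows "\<exists>(P :: 'a set set) (L :: 'a set set set) (\<theta> :: 'a \<Rightarrow> 'a set \<Rightarrow> 'a set).
           projective_plane_of_order n P L \<and>
           acts_by_collineations G P L \<theta> \<and>
           soft_group P L (\<theta> ` carrier G) \<and>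
           soft_plane P L"
proof -
  interpret soft_triple G A B M n k
    by (intro soft_triple.intro soft_triple_axioms.intro) (fact assms)+
  have "projective_plane_of_order n points lines"
    using projective_plane card_line by (simp add: projective_plane_of_order_def)
  moreover have "soft_plane points lines"
    using soft unfolding soft_plane_def by blast
  ultimately show ?thesis
    using acts soft by blast
qed

end
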